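(* Let $$f(x)=\frac{1}{\cos(x)^{s+1}} +\int_{0}^{x}\frac{dy}{\cos(y)^{t+1}},$$ regarded as a formal power series in $x$ whose coefficients are polynomials in the parameters $s,t$. Let $n\ge1$, $\bar n=\lceil n/2\rceil$ and $\underline n=\lfloor n/2\rfloor$. Then, for all $s,t$, $$\ddot H_n(f)= (-1)^{\binom{\bar n}{2}} \Bigl(\prod_{i=0}^{n-1}(2i)!\Bigr) \Bigl(\prod_{l=0}^{\bar n-1}(s+1)_{2l}\Bigr) \Bigl(\prod_{m=0}^{\underline n-1}(t+1)_{2m}\Bigr) \prod_{r=1}^{\bar n}\prod_{c=1}^{\underline n} \frac{(t-s)/2+c-r}{n-r-c+1}.$$
   Context: For a power series $f(x)=\sum_{k\ge0}a_kx^k/k!$, the dilated Hankel determinant is $\ddot H_n(f)=\det(a_{2i+j})_{0\le i,j\le n-1}$. $(\gamma)_m=\gamma(\gamma+1)\cdots(\gamma+m-1)$ is the Pochhammer symbol; empty products equal $1$. *)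

theory Defs
  imports
    "HOL-Computational_Algebra.Formal_Power_Series"
    "Jordan_Normal_Form.Determinant"
begin

text \<open>
  The series is exponential: the entries are \<open>a\<^sub>k = k! [x\<^sup>k] f\<close>.
\<close>

definition dilated_hankel_det :: "nat \<Rightarrow> 'a::field_char_0 fps \<Rightarrow> 'a" where
  "dilated_hankel_det n f =
     det (mat n n (\<lambda>(i, j). fact (2 * i + j) * fps_nth f (2 * i + j)))"

text \<open>
  The formal power series \<open>1 / cos(x)\<^sup>a\<close> for an arbitrary exponent \<open>a\<close>: the binomial
  series \<open>(1 + u)\<^sup>-\<^sup>a\<close> at \<open>u = cos(x) - 1\<close>, which has constant term zero.
  Its coefficients are polynomials in \<open>a\<close>.
\<close>

definition fps_sec_power :: "'a::field_char_0 \<Rightarrow> 'a fps" where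
  "fps_sec_power a = fps_binomial (- a) oo (fps_cos 1 - 1)"

lemma fps_sec_power_add:
  "fps_sec_power (a + b) = fps_sec_power a * fps_sec_power b"
proof -
  have "fps_binomial (- (a + b)) = fps_binomial (- a) * fps_binomial (- b)"
    by (simp flip: fps_binomial_add_mult)
  then show ?thesis
    unfolding fps_sec_power_def by (simp only:) (rule fps_compose_mult_distrib, simp)
qed

lemma fps_sec_power_of_nat:
  "fps_sec_power (of_nat m :: 'a::field_char_0) = inverse (fps_cos 1 ^ m)"
proof -
  have c0: "fps_nth (fps_cos 1 - 1 :: 'a fps) 0 = 0"
    by simp
  have "fps_sec_power (of_nat m :: 'a) = inverse ((1 + fps_X) ^ m oo (fps_cos 1 - 1))"
    unfolding fps_sec_power_def fps_binomial_minus_of_nat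
    by (rule fps_inverse_compose) (simp_all add: fps_power_zeroth)
  then show ?thesis
    by (simp add: fps_compose_add_distrib flip: fps_compose_power[OF c0])
qed

definition sec_series :: "'a::field_char_0 \<Rightarrow> 'a \<Rightarrow> 'a fps" where
  "sec_series s t = fps_sec_power (s + 1) + fps_integral0 (fps_sec_power (t + 1))"

end

theory Submission
  imports Defs
begin

text \<open>
  Repeated use of \<open>D\<^sup>2 sec\<^sup>a = a(a + 1) sec\<^sup>a\<^sup>+\<^sup>2 - a\<^sup>2 sec\<^sup>a\<close> turns the Hankel matrix, up to a triangular factor,
  into the matrix of coefficients at \<open>x\<^sup>2\<^sup>i\<close> of \<open>sec\<^sup>s, sec\<^sup>t, sec\<^sup>s\<^sup>+\<^sup>2, sec\<^sup>t\<^sup>+\<^sup>2, \<dots>\<close>. Multiplying all these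
  series by one series with constant term \<open>1\<close> preserves the determinant, so \<open>s = 0\<close> may be assumed;
  then the first column is a unit vector and can be removed. Since \<open>D sec\<^sup>a = a tan \<cdot> sec\<^sup>a\<close> and
  \<open>tan / x\<close> has constant term \<open>1\<close>, the remaining minor is, up to an explicit factor, the same
  determinant of size one less with parameters \<open>(t, 2)\<close>. This recursion also holds for the product.
\<close>

section \<open>Determinants: triangular factors, scaling, a unit column\<close>

text \<open>The hypothesis is a matrix product written entrywise, so that coefficient functions can
  be supplied directly; the sum bound \<open>k \<le> i\<close> makes the left factor triangular, and
  \<open>det\<close> is multiplicative.\<close>

lemma det_lower_triangular_factor:
  fixes M :: "nat \<Rightarrow> nat \<Rightarrow> 'a::comm_ring_1"
  assumes A: "\<And>i j. i < n \<Longrightarrow> j < n \<Longrightarrow> A i j = (\<Sum>k\<le>i. L i k * M k j)"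
  shows "det (mat n n (\<lambda>(i, j). A i j)) = (\<Prod>i<n. L i i) * det (mat n n (\<lambda>(i, j). M i j))"
proof -
  let ?L = "mat n n (\<lambda>(i, k). if k \<le> i then L i k else 0)"
  have "mat n n (\<lambda>(i, j). A i j) = ?L * mat n n (\<lambda>(i, j). M i j)"
  proof (rule eq_matI)
    fix i j assume "i < dim_row (?L * mat n n (\<lambda>(i, j). M i j))"
      and "j < dim_col (?L * mat n n (\<lambda>(i, j). M i j))"
    then have ij: "i < n" "j < n" by auto
    have "A i j = (\<Sum>k<n. (if k \<le> i then L i k else 0) * M k j)"
      unfolding A[OF ij] using ij by (intro sum.mono_neutral_cong_left) auto
    then show "mat n n (\<lambda>(i, j). A i j) $$ (i, j) = (?L * mat n n (\<lambda>(i, j). M i j)) $$ (i, j)"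
      using ij by (simp add: scalar_prod_def atLeast0LessThan)
  qed auto
  moreover have "det ?L = (\<Prod>i<n. L i i)"
    by (subst det_lower_triangular[of n]) (auto simp: prod_list_diag_prod atLeast0LessThan)
  ultimately show ?thesis
    by (simp add: det_mult[of _ n])
qed

lemma det_upper_triangular_factor:
  fixes M :: "nat \<Rightarrow> nat \<Rightarrow> 'a::comm_ring_1"
  assumes A: "\<And>i j. i < n \<Longrightarrow> j < n \<Longrightarrow> A i j = (\<Sum>k\<le>j. M i k * U k j)"
  shows "det (mat n n (\<lambda>(i, j). A i j)) = det (mat n n (\<lambda>(i, j). M i j)) * (\<Prod>j<n. U j j)"
proof -
  let ?U = "mat n n (\<lambda>(k, j). if k \<le> j then U k j else 0)"
  have "mat n n (\<lambda>(i, j). A i j) = mat n n (\<lambda>(i, j). M i j) * ?U"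
  proof (rule eq_matI)
    fix i j assume "i < dim_row (mat n n (\<lambda>(i, j). M i j) * ?U)"
      and "j < dim_col (mat n n (\<lambda>(i, j). M i j) * ?U)"
    then have ij: "i < n" "j < n" by auto
    have "A i j = (\<Sum>k<n. M i k * (if k \<le> j then U k j else 0))"
      unfolding A[OF ij] using ij by (intro sum.mono_neutral_cong_left) auto
    then show "mat n n (\<lambda>(i, j). A i j) $$ (i, j) = (mat n n (\<lambda>(i, j). M i j) * ?U) $$ (i, j)"
      using ij by (simp add: scalar_prod_def atLeast0LessThan)
  qed auto
  moreover have "det ?U = (\<Prod>i<n. U i i)"
    by (subst det_upper_triangular[of _ n])
      (auto simp: prod_list_diag_prod atLeast0LessThan upper_triangular_def)
  ultimately show ?thesis
    by (simp add: det_mult[of _ n])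
qed

lemma det_scale_rows:
  fixes M :: "nat \<Rightarrow> nat \<Rightarrow> 'a::comm_ring_1"
  shows "det (mat n n (\<lambda>(i, j). a i * M i j)) = (\<Prod>i<n. a i) * det (mat n n (\<lambda>(i, j). M i j))"
  by (subst det_lower_triangular_factor[where L = "\<lambda>i k. if i = k then a i else 0" and M = M])
    (simp_all add: if_distrib[of "\<lambda>x. x * _"] cong: if_cong)

lemma det_scale_columns:
  fixes M :: "nat \<Rightarrow> nat \<Rightarrow> 'a::comm_ring_1"
  shows "det (mat n n (\<lambda>(i, j). M i j * b j)) = det (mat n n (\<lambda>(i, j). M i j)) * (\<Prod>j<n. b j)"
  by (subst det_upper_triangular_factor[where U = "\<lambda>k j. if k = j then b j else 0" and M = M])
    (simp_all add: if_distrib[of "\<lambda>x. _ * x"] cong: if_cong)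

lemma det_first_column_unit:
  fixes M :: "nat \<Rightarrow> nat \<Rightarrow> 'a::comm_ring_1"
  assumes "\<And>i. M i 0 = (if i = 0 then 1 else 0)"
  shows "det (mat (Suc n) (Suc n) (\<lambda>(i, j). M i j)) = det (mat n n (\<lambda>(i, j). M (Suc i) (Suc j)))"
proof -
  let ?A = "mat (Suc n) (Suc n) (\<lambda>(i, j). M i j)"
  have "det ?A = (\<Sum>i<Suc n. ?A $$ (i, 0) * cofactor ?A i 0)"
    by (rule laplace_expansion_column) auto
  also have "\<dots> = (\<Sum>i<Suc n. if i = 0 then cofactor ?A 0 0 else 0)"
    by (intro sum.cong) (auto simp: assms)
  also have "\<dots> = det (mat_delete ?A 0 0)"
    by (simp add: cofactor_def)
  also have "mat_delete ?A 0 0 = mat n n (\<lambda>(i, j). M (Suc i) (Suc j))"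
    by (rule eq_matI) (auto simp: mat_delete_def)
  finally show ?thesis .
qed

section \<open>Secant powers: parity and derivatives\<close>

unbundle fps_syntax
no_notation vec_index (infixl "$" 100)

lemma fps_sec_power_0 [simp]: "fps_sec_power 0 = 1"
  by (simp add: fps_sec_power_def)

lemma fps_sec_power_nth_0 [simp]: "fps_sec_power a $ 0 = 1"
  by (simp add: fps_sec_power_def)

text \<open>Substituting \<open>- fps_X\<close> fixes \<open>fps_cos 1\<close>, hence every series
  composed with \<open>fps_cos 1 - 1\<close>.\<close>

lemma fps_sec_power_nth_odd:
  assumes "odd k"
  shows "fps_sec_power a $ k = 0"
proof -
  have cos: "(fps_cos 1 - 1 :: 'a fps) oo - fps_X = fps_cos 1 - 1"
    by (simp add: fps_eq_iff fps_compose_uminus' fps_cos_def)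
  have "fps_sec_power a oo - fps_X = fps_sec_power a"
    unfolding fps_sec_power_def
    by (subst fps_compose_assoc[symmetric]) (simp_all add: cos)
  then have "(- 1) ^ k * fps_sec_power a $ k = fps_sec_power a $ k"
    by (simp add: fps_compose_uminus' fps_eq_iff)
  then show ?thesis using assms by simp
qed

lemma fps_cos_mult_tan: "fps_cos 1 * fps_tan 1 = (fps_sin 1 :: 'a::field_char_0 fps)"
proof -
  have "fps_tan 1 = fps_sin 1 * inverse (fps_cos 1 :: 'a fps)"
    by (simp add: fps_tan_def fps_divide_unit)
  then show ?thesis
    by (simp add: inverse_mult_eq_1' mult.left_commute)
qed

lemma fps_sec_power_2:
  "fps_sec_power (2::'a) = 1 + (fps_tan 1)\<^sup>2"
  "fps_deriv (fps_tan 1) = fps_sec_power (2::'a::field_char_0)"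
proof -
  let ?c = "fps_cos 1 :: 'a fps"
  have nz: "?c\<^sup>2 \<noteq> 0"
    by (metis fps_cos_nth_0 fps_zero_nth power_not_zero zero_neq_one)
  have sec: "fps_sec_power 2 = inverse (?c\<^sup>2)"
    using fps_sec_power_of_nat[of 2, where 'a = 'a] by simp
  have "?c\<^sup>2 * fps_sec_power 2 = 1"
    unfolding sec by (rule inverse_mult_eq_1') (simp add: fps_power_zeroth)
  moreover have "?c\<^sup>2 * (1 + (fps_tan 1)\<^sup>2) = 1"
    using fps_sin_cos_sum_of_squares[of "1::'a"]
    by (simp add: distrib_left fps_cos_mult_tan flip: power_mult_distrib)
  ultimately show "fps_sec_power 2 = 1 + (fps_tan 1 :: 'a fps)\<^sup>2"
    using nz by (metis mult_left_cancel)
  show "fps_deriv (fps_tan 1) = fps_sec_power (2::'a)"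
    by (simp add: fps_tan_deriv sec fps_divide_unit fps_power_zeroth)
qed

text \<open>The equation \<open>(1 + X) B' = - a B\<close> for the binomial series, composed with
  \<open>u = cos - 1\<close>, reads \<open>(B' o u) cos = - a sec^a\<close>. The chain rule
  contributes \<open>- sin = - cos tan\<close>, and one factor \<open>cos\<close> cancels.\<close>

lemma fps_deriv_sec_power:
  "fps_deriv (fps_sec_power a) = fps_const a * (fps_tan 1 * fps_sec_power (a::'a::field_char_0))"
proof -
  let ?u = "fps_cos 1 - 1 :: 'a fps" and ?B = "fps_binomial (- a)"
  have u0: "?u $ 0 = 0" by simp
  have "fps_deriv ?B * (1 + fps_X) = fps_const (- a) * ?B"
    by (simp add: fps_binomial_deriv fps_divide_unit mult.assoc inverse_mult_eq_1)
  then have "(fps_deriv ?B * (1 + fps_X)) oo ?u = (fps_const (- a) * ?B) oo ?u"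
    by simp
  then have B: "(fps_deriv ?B oo ?u) * fps_cos 1 = fps_const (- a) * fps_sec_power a"
    by (simp add: fps_compose_mult_distrib[OF u0] fps_compose_add_distrib fps_sec_power_def
        del: fps_const_neg)
  have "fps_deriv (fps_sec_power a) * fps_cos 1 = - ((fps_deriv ?B oo ?u) * fps_cos 1) * fps_sin 1"
    by (simp add: fps_sec_power_def fps_compose_deriv fps_cos_deriv algebra_simps flip: fps_const_neg)
  also have "\<dots> = fps_const a * fps_sec_power a * (fps_cos 1 * fps_tan 1)"
    unfolding B fps_cos_mult_tan by (simp flip: fps_const_neg)
  finally have "fps_deriv (fps_sec_power a) * fps_cos 1
      = (fps_const a * (fps_tan 1 * fps_sec_power a)) * fps_cos 1"
    by (simp add: algebra_simps)
  moreover have "fps_cos 1 \<noteq> (0 :: 'a fps)"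
    by (metis fps_cos_nth_0 fps_zero_nth zero_neq_one)
  ultimately show ?thesis by simp
qed

text \<open>Two differentiations give \<open>a^2 tan^2 sec^a + a sec^2 sec^a\<close>; then
  \<open>tan^2 = sec^2 - 1\<close>.\<close>

lemma fps_deriv2_sec_power:
  "fps_deriv (fps_deriv (fps_sec_power a))
     = fps_const (a * (a + 1)) * fps_sec_power (a + 2) - fps_const (a\<^sup>2) * fps_sec_power a"
proof -
  let ?S = "fps_sec_power a" and ?T = "fps_tan 1 :: 'a fps" and ?c = "fps_const a"
  have "fps_deriv (fps_deriv ?S) = ?c * (?T * (?c * (?T * ?S)) + fps_sec_power 2 * ?S)"
    by (simp add: fps_deriv_sec_power fps_sec_power_2(2))
  also have "\<dots> = ?c * (?c + 1) * (?S * fps_sec_power 2) - ?c\<^sup>2 * ?S"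
    unfolding fps_sec_power_2(1)
    by (simp add: algebra_simps power2_eq_square del: fps_const_mult fps_const_add)
  also have "?c * (?c + 1) = fps_const (a * (a + 1))"
    by (metis fps_const_1_eq_1 fps_const_add fps_const_mult)
  finally show ?thesis
    by (simp add: fps_sec_power_add power2_eq_square)
qed

section \<open>Even-order derivatives of secant powers at 0\<close>

definition sec_number :: "'a::field_char_0 \<Rightarrow> nat \<Rightarrow> 'a" where
  "sec_number a k = fact (2 * k) * fps_sec_power a $ (2 * k)"

lemma sec_number_Suc:
  "sec_number a (Suc k) = a * (a + 1) * sec_number (a + 2) k - a\<^sup>2 * sec_number a k"
proof -
  have "sec_number a (Suc k) = fact (2 * k) * fps_deriv (fps_deriv (fps_sec_power a)) $ (2 * k)"
    by (simp add: sec_number_def algebra_simps)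
  then show ?thesis
    by (simp add: fps_deriv2_sec_power sec_number_def algebra_simps del: fps_deriv_nth)
qed

text \<open>\<open>sec_coeff a l m\<close> is the coefficient of \<open>sec\<^sup>a\<^sup>+\<^sup>2\<^sup>m\<close> in the \<open>2l\<close>-th derivative of \<open>sec\<^sup>a\<close>.\<close>

primrec sec_coeff :: "'a::field_char_0 \<Rightarrow> nat \<Rightarrow> nat \<Rightarrow> 'a" where
  "sec_coeff a 0 m = (if m = 0 then 1 else 0)"
| "sec_coeff a (Suc l) m =
    (case m of 0 \<Rightarrow> 0 | Suc k \<Rightarrow> (a + of_nat (2 * k)) * (a + of_nat (2 * k) + 1) * sec_coeff a l k)
    - (a + of_nat (2 * m))\<^sup>2 * sec_coeff a l m"

lemma sec_coeff_eq_0: "l < m \<Longrightarrow> sec_coeff a l m = 0"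
  by (induction l arbitrary: m) (auto split: nat.split)

text \<open>The exponent \<open>a + 2l\<close> is reached only if all \<open>l\<close> steps raise
  it; the factors \<open>(a + 2k)(a + 2k + 1)\<close> join up to one Pochhammer symbol.\<close>

lemma sec_coeff_diag: "sec_coeff a l l = pochhammer a (2 * l)"
  by (induction l) (simp_all add: sec_coeff_eq_0 pochhammer_Suc algebra_simps)

text \<open>Induction with \<open>k\<close> arbitrary: \<open>k + Suc l\<close> is read as
  \<open>Suc k + l\<close>, and \<open>sec_number_Suc\<close> splits each term into one with raised
  and one with unchanged exponent. The coefficients are independent of \<open>k\<close>, so in the
  Hankel matrix this becomes a column operation.\<close>

lemma sec_number_add:
  "sec_number a (k + l) = (\<Sum>m\<le>l. sec_coeff a l m * sec_number (a + of_nat (2 * m)) k)"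
proof (induction l arbitrary: k)
  case 0
  show ?case by simp
next
  case (Suc l)
  let ?b = "\<lambda>m. a + of_nat (2 * m)" and ?c = "sec_coeff a l"
  have "sec_number a (k + Suc l) = (\<Sum>m\<le>l. ?c m * sec_number (?b m) (Suc k))"
    using Suc[of "Suc k"] by simp
  also have "\<dots> = (\<Sum>m\<le>l. ?b m * (?b m + 1) * ?c m * sec_number (?b (Suc m)) k)
      - (\<Sum>m\<le>l. (?b m)\<^sup>2 * ?c m * sec_number (?b m) k)"
    unfolding sec_number_Suc sum_subtractf[symmetric]
    by (intro sum.cong) (simp_all add: algebra_simps)
  also have "(\<Sum>m\<le>l. ?b m * (?b m + 1) * ?c m * sec_number (?b (Suc m)) k)
      = (\<Sum>m\<le>Suc l. (case m of 0 \<Rightarrow> 0 | Suc j \<Rightarrow> ?b j * (?b j + 1) * ?c j) * sec_number (?b m) k)"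
    by (subst sum.atMost_Suc_shift) simp
  \<comment> \<open>The new term \<open>m = Suc l\<close> vanishes, since
    \<open>sec_coeff a l (Suc l) = 0\<close>.\<close>
  also have "(\<Sum>m\<le>l. (?b m)\<^sup>2 * ?c m * sec_number (?b m) k)
      = (\<Sum>m\<le>Suc l. (?b m)\<^sup>2 * ?c m * sec_number (?b m) k)"
    by (simp add: sec_coeff_eq_0)
  also have "(\<Sum>m\<le>Suc l. (case m of 0 \<Rightarrow> 0 | Suc j \<Rightarrow> ?b j * (?b j + 1) * ?c j) * sec_number (?b m) k)
      - (\<Sum>m\<le>Suc l. (?b m)\<^sup>2 * ?c m * sec_number (?b m) k)
      = (\<Sum>m\<le>Suc l. sec_coeff a (Suc l) m * sec_number (?b m) k)"
    unfolding sum_subtractf[symmetric] by (intro sum.cong) (simp_all add: algebra_simps)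
  finally show ?case .
qed

section \<open>Determinants of even secant coefficients and their recursion\<close>

definition interlace :: "'a \<Rightarrow> 'a \<Rightarrow> nat \<Rightarrow> 'a::field_char_0" where
  "interlace s t j = (if even j then s else t) + of_nat (2 * (j div 2))"

definition sec_det :: "nat \<Rightarrow> 'a \<Rightarrow> 'a \<Rightarrow> 'a::field_char_0" where
  "sec_det n s t = det (mat n n (\<lambda>(i, j). fps_sec_power (interlace s t j) $ (2 * i)))"

lemma fps_mult_even_nth:
  fixes g h :: "'a::comm_ring_1 fps"
  assumes "\<And>k. odd k \<Longrightarrow> g $ k = 0"
  shows "(h * g) $ (2 * i) = (\<Sum>k\<le>i. h $ (2 * (i - k)) * g $ (2 * k))"
proof -
  have "(h * g) $ (2 * i) = (\<Sum>k\<in>{0..2 * i}. h $ (2 * i - k) * g $ k)"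
    by (simp add: mult.commute[of h] fps_mult_nth mult.commute)
  also have "\<dots> = (\<Sum>k\<in>(*) 2 ` {..i}. h $ (2 * i - k) * g $ k)"
  proof (rule sum.mono_neutral_right)
    show "\<forall>k\<in>{0..2 * i} - (*) 2 ` {..i}. h $ (2 * i - k) * g $ k = 0"
    proof
      fix k assume k: "k \<in> {0..2 * i} - (*) 2 ` {..i}"
      have "odd k" using k by (auto elim!: evenE)
      then show "h $ (2 * i - k) * g $ k = 0" by (simp add: assms)
    qed
  qed auto
  also have "\<dots> = (\<Sum>k\<le>i. h $ (2 * (i - k)) * g $ (2 * k))"
    by (subst sum.reindex) (auto simp: inj_on_def diff_mult_distrib2)
  finally show ?thesis .
qed

text \<open>On the even coefficients of even series, multiplication by \<open>h\<close> acts as a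
  lower triangular Toeplitz matrix with \<open>h $ 0 = 1\<close> on the diagonal.\<close>

lemma det_even_coeffs_mult:
  fixes h :: "'a::comm_ring_1 fps"
  assumes "h $ 0 = 1" and "\<And>j k. odd k \<Longrightarrow> g j $ k = 0"
  shows "det (mat n n (\<lambda>(i, j). (h * g j) $ (2 * i))) = det (mat n n (\<lambda>(i, j). g j $ (2 * i)))"
  by (subst det_lower_triangular_factor
        [where L = "\<lambda>i k. h $ (2 * (i - k))" and M = "\<lambda>k j. g j $ (2 * k)"])
    (simp_all add: fps_mult_even_nth assms)

lemma sec_det_shift: "sec_det n (s + r) (t + r) = sec_det n s t"
proof -
  have "interlace (s + r) (t + r) j = r + interlace s t j" for j
    by (simp add: interlace_def)
  then show ?thesis
    unfolding sec_det_def
    by (simp add: fps_sec_power_add det_even_coeffs_mult fps_sec_power_nth_odd)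
qed

text \<open>Dropping the leading 0 from 0, r, 2, r + 2, 4, ... leaves r, 2, r + 2, 4, ..., which is
  interlaced again.\<close>

lemma interlace_Suc: "interlace 0 r (Suc j) = interlace r 2 j"
  by (auto simp: interlace_def elim!: evenE oddE)

lemma sec_det_Suc:
  "sec_det (Suc n) 0 r = (\<Prod>j<n. interlace r 2 j) / (2 ^ n * fact n) * sec_det n r 2"
proof -
  let ?w = "interlace r 2"
  \<comment> \<open>This is \<open>tan(x) / x\<close>, the common multiplier to be removed by
    \<open>det_even_coeffs_mult\<close>.\<close>
  define K where "K = fps_shift 1 (fps_tan 1 :: 'a fps)"
  have T0: "(fps_tan 1 :: 'a fps) $ 0 = 0"
    using arg_cong[OF fps_cos_mult_tan, of "\<lambda>f. f $ 0"] by simp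
  have "fps_deriv (fps_tan 1) $ 0 = (1::'a)"
    by (simp only: fps_sec_power_2(2) fps_sec_power_nth_0)
  then have K0: "K $ 0 = 1"
    by (simp add: K_def)
  have T: "fps_tan 1 = fps_X * K"
    using T0 by (simp add: K_def fps_eq_iff)
  \<comment> \<open>Comparing coefficients of the derivative at the odd index \<open>2i + 1\<close>,
    where the factor \<open>fps_X\<close> of \<open>tan\<close> lowers the index to
    \<open>2i\<close>. What remains outside depends on the row alone or on the column alone.\<close>
  have entry: "fps_sec_power (?w j) $ (2 * Suc i)
      = (1 / of_nat (2 * Suc i)) * ((K * fps_sec_power (?w j)) $ (2 * i) * ?w j)" for i j
  proof -
    have "of_nat (2 * Suc i) * fps_sec_power (?w j) $ (2 * Suc i)
        = fps_deriv (fps_sec_power (?w j)) $ Suc (2 * i)"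
      by simp
    also have "\<dots> = ?w j * (K * fps_sec_power (?w j)) $ (2 * i)"
      by (simp add: fps_deriv_sec_power T mult.assoc del: fps_deriv_nth)
    finally show ?thesis
      by (simp add: field_simps del: of_nat_Suc of_nat_mult mult_Suc_right)
  qed
  \<comment> \<open>Column 0 has exponent 0, so its series is 1.\<close>
  have "sec_det (Suc n) 0 r
      = det (mat n n (\<lambda>(i, j). fps_sec_power (interlace 0 r (Suc j)) $ (2 * Suc i)))"
    unfolding sec_det_def
    by (rule det_first_column_unit) (simp add: interlace_def)
  also have "\<dots> = (\<Prod>i<n. 1 / of_nat (2 * Suc i))
      * det (mat n n (\<lambda>(i, j). (K * fps_sec_power (?w j)) $ (2 * i) * ?w j))"
    unfolding interlace_Suc entry by (rule det_scale_rows)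
  also have "det (mat n n (\<lambda>(i, j). (K * fps_sec_power (?w j)) $ (2 * i) * ?w j))
      = det (mat n n (\<lambda>(i, j). (K * fps_sec_power (?w j)) $ (2 * i))) * (\<Prod>j<n. ?w j)"
    by (rule det_scale_columns)
  also have "det (mat n n (\<lambda>(i, j). (K * fps_sec_power (?w j)) $ (2 * i))) = sec_det n r 2"
    unfolding sec_det_def by (simp add: det_even_coeffs_mult K0 fps_sec_power_nth_odd)
  also have "(\<Prod>i<n. 1 / of_nat (2 * Suc i) :: 'a) = 1 / (2 ^ n * fact n)"
  proof -
    have "(\<Prod>i<n. of_nat (2 * Suc i) :: 'a) = 2 ^ n * fact n"
      by (induction n) (simp_all add: algebra_simps)
    then show ?thesis
      by (simp only: prod_dividef prod.neutral_const)
  qed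
  finally show ?thesis by simp
qed

section \<open>The double product and the closed form of \<open>sec_det\<close>\<close>

lemma prod_interlace:
  fixes f g :: "nat \<Rightarrow> 'a::comm_monoid_mult"
  shows "(\<Prod>j<n. if even j then f (j div 2) else g (j div 2))
    = (\<Prod>l<(n + 1) div 2. f l) * (\<Prod>m<n div 2. g m)"
proof (induction n)
  case (Suc n)
  then show ?case
    by (cases "even n") (auto elim!: evenE oddE simp: ac_simps)
qed simp

text \<open>The double product of the theorem, with \<open>p + q\<close> for \<open>n\<close> and
  \<open>b\<close> for \<open>(t - s) / 2\<close>. Separate \<open>p\<close> and \<open>q\<close>
  can exchange roles in the recursion.\<close>

definition sec_prod :: "nat \<Rightarrow> nat \<Rightarrow> 'a \<Rightarrow> 'a::field_char_0" where
  "sec_prod p q b = (\<Prod>r=1..p. \<Prod>c=1..q.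
     (b + of_nat c - of_nat r) / (of_nat (p + q) - of_nat r - of_nat c + 1))"

text \<open>These are the denominators of row \<open>r = 1\<close> in
  \<open>sec_prod (Suc q) p\<close>, running from \<open>p + q\<close> down to
  \<open>q + 1\<close>.\<close>

lemma prod_fact_quotient:
  "(\<Prod>c=1..p. of_nat (p + q) - of_nat c + 1) = (fact (p + q) / fact q :: 'a::field_char_0)"
proof (induction p)
  case (Suc p)
  have "(\<Prod>c=1..Suc p. of_nat (Suc p + q) - of_nat c + 1 :: 'a)
      = of_nat (Suc p + q) * (\<Prod>c=Suc 1..Suc p. of_nat (Suc p + q) - of_nat c + 1)"
    by (subst prod.atLeast_Suc_atMost) simp_all
  also have "(\<Prod>c=Suc 1..Suc p. of_nat (Suc p + q) - of_nat c + 1 :: 'a)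
      = (\<Prod>c=1..p. of_nat (p + q) - of_nat c + 1)"
    by (subst prod.shift_bounds_cl_Suc_ivl) (simp add: algebra_simps)
  finally show ?case using Suc by simp
qed simp

text \<open>Row \<open>r = 1\<close> is split off. In the others, with \<open>r\<close> shifted by
  one, the numerator is \<open>b + c - r - 1 = - ((1 - b) + r - c)\<close>; exchanging
  \<open>r\<close> and \<open>c\<close> gives the transposed product at \<open>1 - b\<close> and
  \<open>p * q\<close> signs.\<close>

lemma sec_prod_Suc:
  "sec_prod (Suc q) p b
     = (- 1) ^ (p * q) * pochhammer b p * fact q / fact (p + q) * sec_prod p q (1 - b)"
proof -
  let ?t = "\<lambda>r c. (b + of_nat c - of_nat r) / (of_nat (Suc q + p) - of_nat r - of_nat c + 1)"
  have "sec_prod (Suc q) p b = (\<Prod>c=1..p. ?t 1 c) * (\<Prod>r=Suc 1..Suc q. \<Prod>c=1..p. ?t r c)"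
    unfolding sec_prod_def by (subst prod.atLeast_Suc_atMost) simp_all
  also have "(\<Prod>c=1..p. ?t 1 c)
      = (\<Prod>c=1..p. b + of_nat c - 1) / (\<Prod>c=1..p. of_nat (p + q) - of_nat c + 1)"
    by (simp add: prod_dividef algebra_simps)
  also have "(\<Prod>c=1..p. b + of_nat c - 1) = pochhammer b p"
    by (induction p) (simp_all add: pochhammer_Suc)
  also have "(\<Prod>r=Suc 1..Suc q. \<Prod>c=1..p. ?t r c)
      = (\<Prod>r=1..q. \<Prod>c=1..p. ?t (Suc r) c)"
    by (rule prod.shift_bounds_cl_Suc_ivl)
  also have "\<dots> = (\<Prod>c=1..p. \<Prod>r=1..q. ?t (Suc r) c)"
    by (rule prod.swap)
  also have "\<dots> = (\<Prod>c=1..p. \<Prod>r=1..q. (- 1) *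
      ((1 - b + of_nat r - of_nat c) / (of_nat (p + q) - of_nat c - of_nat r + 1)))"
    by (intro prod.cong refl) (simp add: algebra_simps flip: minus_divide_left)
  also have "\<dots> = (- 1) ^ (p * q) * sec_prod p q (1 - b)"
    unfolding sec_prod_def
    by (simp only: prod.distrib prod_constant card_atLeastAtMost) (simp add: power_mult mult.commute[of p])
  finally show ?thesis
    unfolding prod_fact_quotient by simp
qed

text \<open>The recursions \<open>sec_det_Suc\<close> and \<open>sec_prod_Suc\<close> match: the
  smaller determinant has parameters \<open>(t - s, 2)\<close>, and half their difference is
  \<open>1 - b\<close>.\<close>

lemma sec_det_eq:
  "sec_det n s t = (- 1) ^ (((n + 1) div 2) choose 2)
     * sec_prod ((n + 1) div 2) (n div 2) ((t - s) / 2)"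
proof (induction n arbitrary: s t)
  case 0
  show ?case by (simp add: sec_det_def sec_prod_def binomial_eq_0)
next
  case (Suc n)
  define p q where "p = (n + 1) div 2" and "q = n div 2"
  have n: "n = p + q" unfolding p_def q_def by presburger
  have pq: "p = q \<or> p = Suc q" unfolding p_def q_def by presburger
  \<comment> \<open>Passing to \<open>Suc n\<close> turns the upper half \<open>p\<close> into the
    lower one and \<open>q\<close> into the upper one, increased by 1.\<close>
  have Sn: "(Suc n + 1) div 2 = Suc q" "Suc n div 2 = p" by (simp_all add: p_def q_def)
  define b where "b = (t - s) / 2"
  have ts: "t - s = 2 * b"
    by (simp add: b_def)
  \<comment> \<open>The factors are \<open>2(b + l)\<close> at even and \<open>2(m + 1)\<close> at
    odd positions; \<open>2 ^ n\<close> will cancel against \<open>sec_det_Suc\<close>.\<close>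
  have w: "(\<Prod>j<n. interlace (t - s) 2 j) = 2 ^ n * (pochhammer b p * fact q)"
  proof -
    have "(\<Prod>j<n. interlace (t - s) 2 j)
        = (\<Prod>j<n. 2 * (if even j then b + of_nat (j div 2) else of_nat (Suc (j div 2))))"
      by (intro prod.cong refl) (simp add: interlace_def ts distrib_left)
    also have "\<dots> = 2 ^ n * ((\<Prod>l<p. b + of_nat l) * (\<Prod>m<q. of_nat (Suc m)))"
      unfolding prod.distrib p_def q_def
      by (subst prod_interlace[where f = "\<lambda>l. b + of_nat l" and g = "\<lambda>m. of_nat (Suc m)"]) simp
    also have "(\<Prod>m<q. of_nat (Suc m) :: 'a) = fact q"
      by (simp add: fact_prod_Suc atLeast0LessThan)
    finally show ?thesis
      by (simp add: pochhammer_prod atLeast0LessThan)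
  qed
  \<comment> \<open>For \<open>p = q\<close> the binomials differ by \<open>q\<close>, which has the
    parity of \<open>q * q\<close>; for \<open>p = Suc q\<close> they agree and \<open>p * q\<close>
    is even.\<close>
  have sign: "(- 1) ^ (p choose 2) = ((- 1) ^ (Suc q choose 2) * (- 1) ^ (p * q) :: 'a)"
    using pq
  proof
    assume p: "p = q"
    have "Suc q choose 2 = q + (q choose 2)" by (simp add: numeral_2_eq_2)
    then show ?thesis
      unfolding p by (simp add: minus_one_power_iff)
  next
    assume p: "p = Suc q"
    then have "even (p * q)" by simp
    then show ?thesis by (simp add: p)
  qed
  have "sec_det (Suc n) s t = sec_det (Suc n) 0 (t - s)"
    using sec_det_shift[of "Suc n" 0 s "t - s"] by simp
  also have "\<dots> = pochhammer b p * fact q / fact n * sec_det n (t - s) 2"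
    by (simp add: sec_det_Suc w)
  also have "sec_det n (t - s) 2 = (- 1) ^ (p choose 2) * sec_prod p q (1 - b)"
    using Suc[of "t - s" 2] by (simp add: p_def q_def b_def diff_divide_distrib)
  finally show ?case
    unfolding Sn sec_prod_Suc sign b_def n[symmetric] by simp
qed

section \<open>Reduction of the dilated Hankel determinant to \<open>sec_det\<close>\<close>

text \<open>The secant power is even and the integral is odd, so the parity of \<open>j\<close>
  selects the summand. Integration moves the coefficient at \<open>2(i + m)\<close> to the next
  index, where the factorial absorbs the division.\<close>

lemma sec_series_hankel_entry:
  "fact (2 * i + j) * sec_series s t $ (2 * i + j)
    = sec_number (if even j then s + 1 else t + 1) (i + j div 2)"
proof (cases "even j")
  case True
  then obtain l where j: "j = 2 * l" by (elim evenE)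
  have "fps_integral0 (fps_sec_power (t + 1)) $ (2 * (i + l)) = 0"
    by (cases "i + l") (simp_all add: fps_integral_def fps_sec_power_nth_odd)
  then show ?thesis
    using j by (simp add: sec_series_def sec_number_def algebra_simps)
next
  case False
  then obtain m where j: "j = 2 * m + 1" by (elim oddE)
  have "fps_integral0 (fps_sec_power (t + 1)) $ Suc (2 * (i + m))
      = fps_sec_power (t + 1) $ (2 * (i + m)) / of_nat (Suc (2 * (i + m)))"
    by (simp add: fps_integral_def divide_inverse mult.commute)
  moreover have "fact (Suc (2 * (i + m))) = (of_nat (Suc (2 * (i + m))) * fact (2 * (i + m)) :: 'a)"
    by (rule fact_Suc)
  ultimately have "fact (Suc (2 * (i + m))) * sec_series s t $ Suc (2 * (i + m))
      = fact (2 * (i + m)) * fps_sec_power (t + 1) $ (2 * (i + m))"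
    by (simp add: sec_series_def fps_sec_power_nth_odd del: of_nat_Suc fact_Suc)
  moreover have "2 * i + j = Suc (2 * (i + m))" "i + j div 2 = i + m"
    by (simp_all add: j)
  ultimately show ?thesis
    using False by (simp add: sec_number_def)
qed

lemma dilated_hankel_det_sec_series:
  "dilated_hankel_det n (sec_series s t) = (\<Prod>i<n. fact (2 * i))
     * (\<Prod>l<(n + 1) div 2. pochhammer (s + 1) (2 * l))
     * (\<Prod>m<n div 2. pochhammer (t + 1) (2 * m)) * sec_det n s t"
proof -
  let ?a = "\<lambda>j. if even j then s + 1 else t + 1"
  let ?w = "interlace (s + 1) (t + 1)"
  \<comment> \<open>Only columns of equal parity combine, since \<open>sec_number_add\<close>
    changes exponents by even amounts.\<close>
  let ?U = "\<lambda>k j. if even k = even j then sec_coeff (?a j) (j div 2) (k div 2) else 0"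
  have entry: "sec_number (?a j) (i + j div 2) = (\<Sum>k\<le>j. sec_number (?w k) i * ?U k j)" for i j
  proof -
    \<comment> \<open>Enumerates the indices \<open>k \<le> j\<close> with the parity of
      \<open>j\<close>.\<close>
    let ?f = "\<lambda>m. 2 * m + j mod 2"
    have "(\<Sum>k\<le>j. sec_number (?w k) i * ?U k j)
        = (\<Sum>k\<in>?f ` {..j div 2}. sec_number (?w k) i * ?U k j)"
    proof (rule sum.mono_neutral_right)
      show "\<forall>k\<in>{..j} - ?f ` {..j div 2}. sec_number (?w k) i * ?U k j = 0"
      proof
        fix k assume k: "k \<in> {..j} - ?f ` {..j div 2}"
        have "even k \<noteq> even j"
        proof
          assume "even k = even j"
          then have "k mod 2 = j mod 2" by presburger
          then have "k = ?f (k div 2)" using mult_div_mod_eq[of 2 k] by simp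
          moreover have "k div 2 \<le> j div 2" using k by (auto intro: div_le_mono)
          ultimately show False using k by blast
        qed
        then show "sec_number (?w k) i * ?U k j = 0" by simp
      qed
    qed (auto, presburger)
    also have "\<dots> = (\<Sum>m\<le>j div 2. sec_number (?w (?f m)) i * ?U (?f m) j)"
      by (subst sum.reindex) (auto simp: inj_on_def)
    also have "\<dots> = (\<Sum>m\<le>j div 2. sec_coeff (?a j) (j div 2) m * sec_number (?a j + of_nat (2 * m)) i)"
      by (intro sum.cong refl) (auto simp: interlace_def)
    finally show ?thesis
      by (simp only: sec_number_add)
  qed
  have "dilated_hankel_det n (sec_series s t)
      = det (mat n n (\<lambda>(i, j). sec_number (?a j) (i + j div 2)))"
    unfolding dilated_hankel_det_def sec_series_hankel_entry ..
  also have "\<dots> = det (mat n n (\<lambda>(i, j). sec_number (?w j) i)) * (\<Prod>j<n. ?U j j)"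
    by (rule det_upper_triangular_factor) (rule entry)
  also have "(\<Prod>j<n. ?U j j) = (\<Prod>j<n. if even j then pochhammer (s + 1) (2 * (j div 2))
      else pochhammer (t + 1) (2 * (j div 2)))"
    by (intro prod.cong refl) (simp add: sec_coeff_diag)
  also have "\<dots> = (\<Prod>l<(n + 1) div 2. pochhammer (s + 1) (2 * l))
      * (\<Prod>m<n div 2. pochhammer (t + 1) (2 * m))"
    by (rule prod_interlace)
  also have "det (mat n n (\<lambda>(i, j). sec_number (?w j) i))
      = (\<Prod>i<n. fact (2 * i)) * sec_det n (s + 1) (t + 1)"
    unfolding sec_det_def sec_number_def by (rule det_scale_rows)
  finally show ?thesis
    unfolding sec_det_shift by (simp only: ac_simps)
qed

theorem proposition7p1:
  fixes s t :: "'a::field_char_0" and n p q :: nat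
  assumes "n \<ge> 1"
    and "p = nat \<lceil>real n / 2\<rceil>"
    and "q = nat \<lfloor>real n / 2\<rfloor>"
  shows "dilated_hankel_det n (sec_series s t) =
    (- 1) ^ (p choose 2)
    * (\<Prod>i<n. fact (2 * i))
    * (\<Prod>l<p. pochhammer (s + 1) (2 * l))
    * (\<Prod>m<q. pochhammer (t + 1) (2 * m))
    * (\<Prod>r=1..p. \<Prod>c=1..q.
        ((t - s) / 2 + of_nat c - of_nat r) / (of_nat n - of_nat r - of_nat c + 1))"
proof -
  have p: "(n + 1) div 2 = p"
    unfolding assms(2) by linarith
  have q: "n div 2 = q"
    unfolding assms(3) by linarith
  have n: "n = p + q"
    using p q by linarith
  show ?thesis
    unfolding dilated_hankel_det_sec_series sec_det_eq p q sec_prod_def n[symmetric]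
    by (simp add: ac_simps)
qed

end
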